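(* Let $n$ be a positive integer and let $L$ be an $n$-element chain, regarded as a lattice. Then there are exactly $F_{2n}$ isomorphism classes of integral operators on $L$, where $F_{2n}$ is the $2n$-th Fibonacci number.
   Context: The Fibonacci numbers are defined by $F_1=F_2=1$ and $F_m=F_{m-1}+F_{m-2}$ for $m\geq 3$. Let $(L,\vee,\wedge)$ be a lattice. A map $P:L\to L$ is an integral operator if for all $x,y\in L$: (1) $P(x\vee y)=P(x)\vee P(y)$, and (2) $P(x)\wedge P(y)=P(P(x)\wedge y)\vee P(x\wedge P(y))$. Two integral operators $P,P'$ on $L$ are isomorphic, written $P\cong P'$, if there is a lattice automorphism $f:L\to L$ with $f\circ P=P'\circ f$. This is an equivalence relation on the set of integral operators on $L$; its equivalence classes are the isomorphism classes of integral operators on $L$. *)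

theory Defs
  imports Main "HOL-Library.Cardinality" "HOL-Number_Theory.Fib"
begin

definition integral_operator :: "('a::lattice \<Rightarrow> 'a) \<Rightarrow> bool" where
  "integral_operator P \<longleftrightarrow>
     (\<forall>x y. P (sup x y) = sup (P x) (P y)) \<and>
     (\<forall>x y. inf (P x) (P y) = sup (P (inf (P x) y)) (P (inf x (P y))))"

definition lattice_automorphism :: "('a::lattice \<Rightarrow> 'a) \<Rightarrow> bool" where
  "lattice_automorphism f \<longleftrightarrow> bij f \<and>
     (\<forall>x y. f (sup x y) = sup (f x) (f y)) \<and>
     (\<forall>x y. f (inf x y) = inf (f x) (f y))"

definition integral_operator_iso :: "(('a::lattice \<Rightarrow> 'a) \<times> ('a \<Rightarrow> 'a)) set" where
  "integral_operator_iso =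
     {(P, P'). integral_operator P \<and> integral_operator P' \<and>
        (\<exists>f. lattice_automorphism f \<and> f \<circ> P = P' \<circ> f)}"

lemma lattice_automorphism_inv:
  assumes "lattice_automorphism f"
  shows "lattice_automorphism (inv f)"
proof -
  from assms have b: "bij f" and
    s: "\<And>x y. f (sup x y) = sup (f x) (f y)" and
    i: "\<And>x y. f (inf x y) = inf (f x) (f y)"
    by (auto simp: lattice_automorphism_def)
  have c: "inv f (f x) = x" "f (inv f x) = x" for x
    using b by (simp_all add: bij_is_inj bij_is_surj surj_f_inv_f)
  have "inv f (sup x y) = sup (inv f x) (inv f y)" for x y
    by (metis c s)
  moreover have "inv f (inf x y) = inf (inv f x) (inv f y)" for x y
    by (metis c i)
  ultimately show ?thesis
    using b by (simp add: lattice_automorphism_def bij_imp_bij_inv)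
qed

lemma equiv_integral_operator_iso:
  "equiv {P. integral_operator P} (integral_operator_iso :: (('a::lattice \<Rightarrow> 'a) \<times> _) set)"
proof (rule equivI)
  show "(integral_operator_iso :: (('a \<Rightarrow> 'a) \<times> _) set)
      \<subseteq> {P. integral_operator P} \<times> {P. integral_operator P}"
    by (auto simp: integral_operator_iso_def)
  have "lattice_automorphism (id :: 'a \<Rightarrow> 'a)"
    by (simp add: lattice_automorphism_def)
  then show "refl_on {P. integral_operator P} (integral_operator_iso :: (('a \<Rightarrow> 'a) \<times> _) set)"
    by (auto simp: refl_on_def integral_operator_iso_def intro!: exI[of _ id])
  show "sym (integral_operator_iso :: (('a \<Rightarrow> 'a) \<times> _) set)"
  proof (rule symI)
    fix P Q :: "'a \<Rightarrow> 'a"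
    assume "(P, Q) \<in> integral_operator_iso"
    then obtain f where *: "integral_operator P" "integral_operator Q"
      "lattice_automorphism f" "f \<circ> P = Q \<circ> f"
      by (auto simp: integral_operator_iso_def)
    then have b: "bij f" by (simp add: lattice_automorphism_def)
    have "inv f (Q x) = P (inv f x)" for x
      using *(4) b by (metis bij_inv_eq_iff comp_apply)
    then have "inv f \<circ> Q = P \<circ> inv f" by auto
    with * show "(Q, P) \<in> integral_operator_iso"
      by (auto simp: integral_operator_iso_def intro: lattice_automorphism_inv)
  qed
  show "trans (integral_operator_iso :: (('a \<Rightarrow> 'a) \<times> _) set)"
  proof (rule transI)
    fix P Q R :: "'a \<Rightarrow> 'a"
    assume "(P, Q) \<in> integral_operator_iso" "(Q, R) \<in> integral_operator_iso"
    then obtain f g where *: "integral_operator P" "integral_operator R"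
      "lattice_automorphism f" "f \<circ> P = Q \<circ> f"
      "lattice_automorphism g" "g \<circ> Q = R \<circ> g"
      by (auto simp: integral_operator_iso_def)
    have "lattice_automorphism (g \<circ> f)"
      using *(3,5) by (auto simp: lattice_automorphism_def intro: bij_comp)
    moreover have "(g \<circ> f) \<circ> P = R \<circ> (g \<circ> f)"
      using *(4,6) by (metis comp_assoc)
    ultimately show "(P, R) \<in> integral_operator_iso"
      using * by (auto simp: integral_operator_iso_def)
  qed
qed

definition integral_operator_classes :: "('a::lattice \<Rightarrow> 'a) set set" where
  "integral_operator_classes = {P. integral_operator P} // integral_operator_iso"

end

theory Submission
  imports Defs "HOL-Library.FuncSet"
begin

text \<open>
  On a chain, condition (2) for an integral operator collapses. Any monotone \<open>P\<close> preserves
  both \<open>sup\<close> and \<open>inf\<close>, so if \<open>P\<close> is moreover idempotent then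
  \<open>P (P x \<sqinter> y)\<close> and \<open>P (x \<sqinter> P y)\<close> are both \<open>P x \<sqinter> P y\<close>. Conversely, condition (2) forces
  \<open>P (P x) = P x\<close>. Hence the integral operators on a chain are exactly its monotone
  idempotent self-maps (\<open>integral_operator_linorder_iff\<close>). A finite chain has no automorphism
  but the identity (\<open>automorphism_finite_chain_eq_id\<close>), so each isomorphism class is a singleton,
  and it remains to count monotone idempotents.

  Let \<open>a\<^sub>n\<close> be the number of monotone idempotents of an \<open>n\<close>-element chain and \<open>b\<^sub>n\<close> the number
  of those that fix its greatest element \<open>t\<close>. Put a new greatest element \<open>b\<close> on top of the
  chain. An idempotent that moves \<open>b\<close> must send it to the image of \<open>t\<close>, so it is determined by
  its restriction, which is arbitrary: this gives \<open>a\<^sub>n\<close> maps. Among those that fix \<open>b\<close>, the ones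
  not sending \<open>t\<close> to \<open>b\<close> restrict to arbitrary monotone idempotents of the old chain (\<open>a\<^sub>n\<close>
  maps), and the ones sending \<open>t\<close> to \<open>b\<close> become, when the value \<open>b\<close> is lowered to \<open>t\<close>,
  idempotents of the old chain that fix \<open>t\<close> (\<open>b\<^sub>n\<close> maps). So \<open>b\<^bsub>n+1\<^esub> = a\<^sub>n + b\<^sub>n\<close> and
  \<open>a\<^bsub>n+1\<^esub> = b\<^bsub>n+1\<^esub> + a\<^sub>n\<close>: the sequence \<open>b\<^sub>1, a\<^sub>1, b\<^sub>2, a\<^sub>2, \<dots>\<close> satisfies the Fibonacci
  recurrence, and it starts with \<open>1, 1\<close>.
\<close>

text \<open>
  Maps on the sub-chain \<open>A\<close> are represented by maps on the whole type that are the identity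
  outside \<open>A\<close>. The maps of a smaller sub-chain are then literally among those of a larger one,
  and for \<open>A = UNIV\<close> the convention is vacuous.
\<close>

definition monotone_idempotents :: "'a::linorder set \<Rightarrow> ('a \<Rightarrow> 'a) set" where
  "monotone_idempotents A =
     {f. f \<in> A \<rightarrow> A \<and> mono_on A f \<and> (\<forall>x\<in>A. f (f x) = f x) \<and> (\<forall>x. x \<notin> A \<longrightarrow> f x = x)}"

lemma monotone_idempotentsI:
  assumes "\<And>x. x \<in> A \<Longrightarrow> f x \<in> A"
    and "\<And>x y. x \<in> A \<Longrightarrow> y \<in> A \<Longrightarrow> x \<le> y \<Longrightarrow> f x \<le> f y"
    and "\<And>x. x \<in> A \<Longrightarrow> f (f x) = f x"
    and "\<And>x. x \<notin> A \<Longrightarrow> f x = x"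
  shows "f \<in> monotone_idempotents A"
  using assms by (auto simp: monotone_idempotents_def intro: mono_onI)

lemma monotone_idempotentsD:
  assumes "f \<in> monotone_idempotents A"
  shows "x \<in> A \<Longrightarrow> f x \<in> A"
    and "x \<in> A \<Longrightarrow> y \<in> A \<Longrightarrow> x \<le> y \<Longrightarrow> f x \<le> f y"
    and "f (f x) = f x"
    and "x \<notin> A \<Longrightarrow> f x = x"
  using assms by (auto simp: monotone_idempotents_def dest: mono_onD)

lemma monotone_idempotents_UNIV:
  "monotone_idempotents UNIV = {f. mono f \<and> (\<forall>x. f (f x) = f x)}"
  by (auto simp: monotone_idempotents_def)

lemma monotone_idempotents_singleton: "monotone_idempotents {a} = {id}"
proof -
  have "f x = x" if "f \<in> monotone_idempotents {a}" for f x
    using monotone_idempotentsD(1,4)[OF that] by (cases "x = a") auto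
  then show ?thesis
    by (auto intro!: monotone_idempotentsI)
qed

lemma finite_monotone_idempotents:
  assumes "finite A"
  shows "finite (monotone_idempotents A)"
proof (rule finite_subset)
  show "monotone_idempotents A \<subseteq> {f. f ` A \<subseteq> A \<and> (\<forall>x. x \<notin> A \<longrightarrow> f x = x)}"
    by (auto simp: monotone_idempotents_def)
  have "inj_on (\<lambda>f. restrict f A) {f. f ` A \<subseteq> A \<and> (\<forall>x. x \<notin> A \<longrightarrow> f x = x)}"
    by (rule inj_on_inverseI[where g = "\<lambda>g x. if x \<in> A then g x else x"])
       (auto simp: fun_eq_iff)
  moreover have "(\<lambda>f. restrict f A) ` {f. f ` A \<subseteq> A \<and> (\<forall>x. x \<notin> A \<longrightarrow> f x = x)} \<subseteq> A \<rightarrow>\<^sub>E A"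
    by auto
  ultimately show "finite {f. f ` A \<subseteq> A \<and> (\<forall>x. x \<notin> A \<longrightarrow> f x = x)}"
    using finite_PiE[OF assms] assms by (meson inj_on_finite)
qed

text \<open>
  If the new greatest element \<open>b\<close> is fixed and \<open>t\<close> is not sent to it, then by monotonicity
  nothing below \<open>b\<close> is sent to it, so the old chain is invariant.
\<close>

lemma idempotents_insert_max_invariant:
  assumes t: "t \<in> A" "\<And>x. x \<in> A \<Longrightarrow> x \<le> t" and b: "t < b"
  shows "{f \<in> monotone_idempotents (insert b A). f b = b \<and> f t \<noteq> b} = monotone_idempotents A"
proof (intro set_eqI iffI)
  fix f assume "f \<in> {f \<in> monotone_idempotents (insert b A). f b = b \<and> f t \<noteq> b}"
  then have f: "f \<in> monotone_idempotents (insert b A)" "f b = b" "f t \<noteq> b" by auto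
  note F = monotone_idempotentsD[OF f(1)]
  have "f t \<in> A" using F(1)[of t] t f by auto
  then have ft: "f t < b" using t b by (meson le_less_trans)
  have "f x \<in> A" if "x \<in> A" for x
    using F(1)[of x] F(2)[of x t] that t ft by auto
  moreover have "f x = x" if "x \<notin> A" for x
    using F(4)[of x] f(2) that by (cases "x = b") auto
  ultimately show "f \<in> monotone_idempotents A"
    using F by (intro monotone_idempotentsI) auto
next
  fix f assume f: "f \<in> monotone_idempotents A"
  note F = monotone_idempotentsD[OF f]
  have below: "x < b" if "x \<in> A" for x using t(2)[OF that] b by simp
  then have bA: "b \<notin> A" by blast
  have "f \<in> monotone_idempotents (insert b A)"
  proof (rule monotone_idempotentsI)
    fix x y assume "x \<in> insert b A" "y \<in> insert b A" "x \<le> y"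
    then show "f x \<le> f y"
      using F(1)[of x] F(2)[of x y] F(4)[OF bA] below[of "f x"] below[of y] by fastforce
  qed (use F bA in auto)
  then show "f \<in> {f \<in> monotone_idempotents (insert b A). f b = b \<and> f t \<noteq> b}"
    using F(1)[OF t(1)] F(4)[OF bA] bA by auto
qed

text \<open>
  If \<open>b\<close> is sent to \<open>m < b\<close>, then \<open>m\<close> is a fixed point with \<open>m \<le> t\<close>, and sandwiching
  \<open>m = f m \<le> f t \<le> f b = m\<close> shows that \<open>t\<close> has the same image.
\<close>

lemma card_idempotents_insert_max_moved:
  assumes t: "t \<in> A" "\<And>x. x \<in> A \<Longrightarrow> x \<le> t" and b: "t < b"
  shows "card {f \<in> monotone_idempotents (insert b A). f b \<noteq> b} = card (monotone_idempotents A)"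
proof -
  have below: "x < b" if "x \<in> A" for x using t(2)[OF that] b by simp
  then have bA: "b \<notin> A" by blast
  have extend: "f(b := f t) \<in> {f \<in> monotone_idempotents (insert b A). f b \<noteq> b}"
    if "f \<in> monotone_idempotents A" for f
  proof -
    note F = monotone_idempotentsD[OF that]
    have "f(b := f t) \<in> monotone_idempotents (insert b A)"
    proof (rule monotone_idempotentsI)
      fix x y assume "x \<in> insert b A" "y \<in> insert b A" "x \<le> y"
      then show "(f(b := f t)) x \<le> (f(b := f t)) y"
        using F(2)[of x t] F(2)[of x y] t below[of y] by fastforce
    next
      fix x assume "x \<in> insert b A"
      then have "f x \<in> A \<or> x = b" "f t \<in> A" using F t by auto
      then show "(f(b := f t)) ((f(b := f t)) x) = (f(b := f t)) x"
        using F(3) bA by auto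
    qed (use F t in auto)
    then show ?thesis
      using F(1)[OF t(1)] bA by auto
  qed
  have image_t: "f t = f b" "f b \<in> A" and restrict: "f(b := b) \<in> monotone_idempotents A"
    if "f \<in> monotone_idempotents (insert b A)" "f b \<noteq> b" for f
  proof -
    note F = monotone_idempotentsD[OF that(1)]
    show fb: "f b \<in> A" using F(1)[of b] that by auto
    have "f (f b) \<le> f t" "f t \<le> f b"
      using F(2)[of "f b" t] F(2)[of t b] fb t b by auto
    then show "f t = f b" using F(3)[of b] by simp
    have A: "f x \<in> A" if "x \<in> A" for x
    proof -
      have "f x \<le> f b" using F(2)[of x b] below[OF that] that by simp
      then show ?thesis using F(1)[of x] that below[OF fb] by auto
    qed
    show "f(b := b) \<in> monotone_idempotents A"
    proof (rule monotone_idempotentsI)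
      fix x assume "x \<in> A"
      then show "(f(b := b)) ((f(b := b)) x) = (f(b := b)) x"
        using F(3) by auto
    qed (use F A bA in auto)
  qed
  have "bij_betw (\<lambda>f. f(b := f t)) (monotone_idempotents A)
          {f \<in> monotone_idempotents (insert b A). f b \<noteq> b}"
  proof (rule bij_betw_byWitness[where f' = "\<lambda>f. f(b := b)"])
    show "\<forall>f\<in>monotone_idempotents A. (f(b := f t))(b := b) = f"
    proof
      fix f assume "f \<in> monotone_idempotents A"
      then have "f b = b" using bA by (rule monotone_idempotentsD(4))
      then show "(f(b := f t))(b := b) = f" by (simp add: fun_upd_idem)
    qed
    show "\<forall>f\<in>{f \<in> monotone_idempotents (insert b A). f b \<noteq> b}.
            (f(b := b))(b := (f(b := b)) t) = f"
      using image_t(1) b by (auto simp: fun_eq_iff)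
  qed (use extend restrict in auto)
  then show ?thesis by (simp add: bij_betw_same_card)
qed

text \<open>
  If \<open>t\<close> is sent to the fixed point \<open>b\<close>, then \<open>t\<close> is not in the image, so the value \<open>b\<close> can be
  renamed to \<open>t\<close> on the old chain without merging it with another value.
\<close>

lemma card_idempotents_insert_max_raised:
  assumes t: "t \<in> A" "\<And>x. x \<in> A \<Longrightarrow> x \<le> t" and b: "t < b"
  shows "card {f \<in> monotone_idempotents (insert b A). f b = b \<and> f t = b}
       = card {f \<in> monotone_idempotents A. f t = t}"
proof -
  have below: "x < b" if "x \<in> A" for x using t(2)[OF that] b by simp
  then have bA: "b \<notin> A" by blast
  define raise where "raise f x = (if f x = t then b else f x)" for f :: "'a \<Rightarrow> 'a" and x
  define lower where "lower f x = (if x \<noteq> b \<and> f x = b then t else f x)" for f :: "'a \<Rightarrow> 'a" and x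
  have raise: "raise f \<in> {f \<in> monotone_idempotents (insert b A). f b = b \<and> f t = b}"
    and lower_raise: "lower (raise f) = f"
    if "f \<in> monotone_idempotents A" "f t = t" for f
  proof -
    note F = monotone_idempotentsD[OF that(1)]
    have fb: "f b = b" using F(4) bA by blast
    have ne: "f x \<noteq> b" if "x \<noteq> b" for x
      using F(1)[of x] F(4)[of x] bA that by metis
    have "raise f \<in> monotone_idempotents (insert b A)"
    proof (rule monotone_idempotentsI)
      fix x assume "x \<in> insert b A"
      then show "raise f x \<in> insert b A" using F fb by (auto simp: raise_def)
    next
      fix x y assume xy: "x \<in> insert b A" "y \<in> insert b A" "x \<le> y"
      show "raise f x \<le> raise f y"
      proof (cases "y = b")
        case True
        then show ?thesis
          using xy fb b F(1)[of x] below[of "f x"] by (auto simp: raise_def)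
      next
        case False
        then have A: "x \<in> A" "y \<in> A" using xy below[of y] by auto
        have "f x \<le> f y" "f y \<le> t" "f x < b"
          using F(1,2) A xy t(2) below by auto
        then show ?thesis by (auto simp: raise_def)
      qed
    next
      fix x show "raise f (raise f x) = raise f x"
        using F(3) fb by (auto simp: raise_def)
    next
      fix x assume "x \<notin> insert b A"
      then show "raise f x = x" using F(4)[of x] t by (auto simp: raise_def)
    qed
    then show "raise f \<in> {f \<in> monotone_idempotents (insert b A). f b = b \<and> f t = b}"
      using that fb b by (auto simp: raise_def)
    show "lower (raise f) = f"
      using ne fb b by (auto simp: fun_eq_iff raise_def lower_def)
  qed
  have lower: "lower f \<in> {f \<in> monotone_idempotents A. f t = t}"
    and raise_lower: "raise (lower f) = f"
    if "f \<in> monotone_idempotents (insert b A)" "f b = b" "f t = b" for f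
  proof -
    note F = monotone_idempotentsD[OF that(1)]
    have ne: "f x \<noteq> t" for x using F(3)[of x] that(3) b by auto
    have "lower f \<in> monotone_idempotents A"
    proof (rule monotone_idempotentsI)
      fix x assume "x \<in> A"
      then show "lower f x \<in> A" using F(1)[of x] bA t by (auto simp: lower_def)
    next
      fix x y assume xy: "x \<in> A" "y \<in> A" "x \<le> y"
      then have "f x \<le> f y" "f x \<in> insert b A" "x \<noteq> b" "y \<noteq> b" "f y \<in> insert b A"
        using F(1,2) bA by auto
      then show "lower f x \<le> lower f y"
        using t(2)[of "f x"] below[of "f y"] by (auto simp: lower_def)
    next
      fix x assume "x \<in> A"
      then show "lower f (lower f x) = lower f x"
        using F(3) that bA b by (auto simp: lower_def)
    next
      fix x assume "x \<notin> A"
      then show "lower f x = x" using F(4)[of x] that by (auto simp: lower_def)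
    qed
    then show "lower f \<in> {f \<in> monotone_idempotents A. f t = t}"
      using that b by (auto simp: lower_def)
    show "raise (lower f) = f"
      using ne that by (auto simp: fun_eq_iff raise_def lower_def)
  qed
  have "bij_betw raise {f \<in> monotone_idempotents A. f t = t}
          {f \<in> monotone_idempotents (insert b A). f b = b \<and> f t = b}"
    by (rule bij_betw_byWitness[where f' = lower])
       (use raise lower raise_lower lower_raise in auto)
  then show ?thesis by (simp add: bij_betw_same_card)
qed

lemma card_Collect_split:
  assumes "finite S"
  shows "card S = card {x \<in> S. Q x} + card {x \<in> S. \<not> Q x}"
proof -
  have "{x \<in> S. Q x} \<union> {x \<in> S. \<not> Q x} = S" by blast
  then show ?thesis
    using card_Un_disjoint[of "{x \<in> S. Q x}" "{x \<in> S. \<not> Q x}"] assms by auto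
qed

text \<open>
  The two counts are proved together because each feeds the recurrence of the other. The
  induction starts at the one-element chain: the empty chain has one idempotent, but
  \<open>fib 0 = 0\<close>.
\<close>

lemma card_monotone_idempotents:
  fixes A :: "'a::linorder set"
  assumes "finite A" "card A = Suc k"
  shows "card (monotone_idempotents A) = fib (2 * k + 2) \<and>
    card {f \<in> monotone_idempotents A. f (Max A) = Max A} = fib (2 * k + 1)"
  using assms
proof (induction A arbitrary: k rule: finite_linorder_max_induct)
  case empty
  then show ?case by simp
next
  case (insert b A)
  show ?case
  proof (cases "A = {}")
    case True
    then have "k = 0" using insert.prems by simp
    moreover have "{f \<in> {id}. f b = b} = {id}" by auto
    ultimately show ?thesis using True
      by (simp add: monotone_idempotents_singleton numeral_2_eq_2)
  next
    case False
    have "b \<notin> A" using insert.hyps by blast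
    then have card_A: "card A = k" using insert by simp
    then obtain j where j: "k = Suc j"
      using False insert.hyps by (cases k) auto
    define t where "t = Max A"
    have t: "t \<in> A" "\<And>x. x \<in> A \<Longrightarrow> x \<le> t"
      using False insert.hyps by (auto simp: t_def)
    then have b: "t < b" using insert.hyps by blast
    have IH: "card (monotone_idempotents A) = fib (2 * j + 2)"
        "card {f \<in> monotone_idempotents A. f t = t} = fib (2 * j + 1)"
      using insert.IH[of j] card_A j by (auto simp: t_def)
    have Max_b: "Max (insert b A) = b"
      using insert.hyps by (intro Max_eqI) (auto intro: less_imp_le)
    let ?I = "monotone_idempotents (insert b A)"
    have fin: "finite ?I" using insert.hyps by (intro finite_monotone_idempotents) simp
    have "card {f \<in> ?I. f b = b}
        = card {f \<in> ?I. f b = b \<and> f t = b} + card {f \<in> ?I. f b = b \<and> f t \<noteq> b}"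
      using card_Collect_split[of "{f \<in> ?I. f b = b}" "\<lambda>f. f t = b"] fin by simp
    also have "\<dots> = fib (2 * j + 1) + fib (2 * j + 2)"
      by (simp only: card_idempotents_insert_max_raised[OF t b]
            idempotents_insert_max_invariant[OF t b] IH)
    finally have fixed: "card {f \<in> ?I. f b = b} = fib (2 * k + 1)"
      by (simp add: j)
    have "card ?I = card {f \<in> ?I. f b = b} + card {f \<in> ?I. f b \<noteq> b}"
      by (rule card_Collect_split[OF fin])
    also have "\<dots> = fib (2 * k + 1) + fib (2 * j + 2)"
      by (simp only: fixed card_idempotents_insert_max_moved[OF t b] IH)
    finally show ?thesis
      using fixed Max_b by (simp add: j)
  qed
qed

text \<open>
  The classes \<open>linorder\<close> and \<open>lattice\<close> share one order, so on a chain \<open>sup\<close> and \<open>inf\<close> return one of their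
  arguments and are preserved by every monotone map.
\<close>

lemma mono_sup_inf_linorder:
  fixes P :: "'a::{linorder,lattice} \<Rightarrow> 'a"
  assumes "mono P"
  shows "P (sup x y) = sup (P x) (P y)" "P (inf x y) = inf (P x) (P y)"
  using linear[of x y] monoD[OF assms, of x y] monoD[OF assms, of y x]
  by (auto simp: sup_absorb1 sup_absorb2 inf_absorb1 inf_absorb2)

lemma integral_operator_linorder_iff:
  fixes P :: "'a::{linorder,lattice} \<Rightarrow> 'a"
  shows "integral_operator P \<longleftrightarrow> mono P \<and> (\<forall>x. P (P x) = P x)"
proof
  assume P: "integral_operator P"
  then have "P (sup x y) = sup (P x) (P y)" for x y
    by (simp add: integral_operator_def)
  then have mono: "mono P"
    by (metis monoI sup.absorb_iff2 sup.cobounded1)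
  have int: "inf (P x) (P y) = sup (P (inf (P x) y)) (P (inf x (P y)))" for x y
    using P by (simp add: integral_operator_def)
  have "P (P x) = P x" for x
  proof (rule antisym)
    \<comment> \<open>Any \<open>y\<close> above both \<open>x\<close> and \<open>P x\<close> makes \<open>P (P x)\<close> a term of condition (2).\<close>
    have "P (inf (P x) (sup x (P x))) \<le> inf (P x) (P (sup x (P x)))"
      by (simp only: int sup.cobounded1)
    then show "P (P x) \<le> P x"
      by (simp add: inf_absorb1)
    \<comment> \<open>The diagonal case of condition (2).\<close>
    have "P x = P (inf (P x) x)"
      using int[of x x] by (simp add: inf.commute)
    also have "\<dots> \<le> P (P x)"
      using mono by (simp add: monoD)
    finally show "P x \<le> P (P x)" .
  qed
  with mono show "mono P \<and> (\<forall>x. P (P x) = P x)" by blast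
next
  assume "mono P \<and> (\<forall>x. P (P x) = P x)"
  then show "integral_operator P"
    by (simp add: integral_operator_def mono_sup_inf_linorder)
qed

text \<open>
  Look at the least moved point \<open>x\<close>. If \<open>f x < x\<close>, then \<open>f x\<close> is fixed and injectivity fails;
  if \<open>f x > x\<close>, then \<open>x\<close> is skipped, since smaller points are fixed and larger ones are sent to
  \<open>f x\<close> or higher.
\<close>

lemma automorphism_finite_chain_eq_id:
  fixes f :: "'a::{linorder,lattice} \<Rightarrow> 'a"
  assumes "finite (UNIV :: 'a set)" "lattice_automorphism f"
  shows "f = id"
proof (rule ccontr)
  assume "f \<noteq> id"
  define M where "M = {x. f x \<noteq> x}"
  have M: "finite M" "M \<noteq> {}"
    using \<open>f \<noteq> id\<close> finite_subset[OF subset_UNIV assms(1)]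
    by (auto simp: M_def fun_eq_iff)
  define x where "x = Min M"
  have moved: "f x \<noteq> x" using Min_in[OF M] by (simp add: x_def M_def)
  have smaller: "f y = y" if "y < x" for y
    using Min_le[OF M(1), of y] that by (force simp: x_def M_def)
  have bij: "bij f" and "f (sup y z) = sup (f y) (f z)" for y z
    using assms(2) by (auto simp: lattice_automorphism_def)
  then have mono: "f y \<le> f z" if "y \<le> z" for y z
    using that by (metis sup.absorb_iff2)
  show False
  proof (cases "f x < x")
    case True
    then have "f (f x) = f x" by (rule smaller)
    then show False using bij moved by (metis bij_is_inj injD)
  next
    case False
    then have "x < f x" using moved by simp
    obtain y where y: "f y = x" using bij by (metis bij_pointE)
    show False
    proof (cases "y < x")
      case True
      then show False using smaller[OF True] y by simp
    next
      case False
      then have "f x \<le> x" using mono[of x y] y by simp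
      then show False using \<open>x < f x\<close> by simp
    qed
  qed
qed

lemma card_integral_operator_classes_finite_chain:
  assumes "finite (UNIV :: 'a::{linorder,lattice} set)"
  shows "card (integral_operator_classes :: ('a \<Rightarrow> 'a) set set)
       = card {P :: 'a \<Rightarrow> 'a. integral_operator P}"
proof -
  have aut: "lattice_automorphism f \<longleftrightarrow> f = id" for f :: "'a \<Rightarrow> 'a"
    using automorphism_finite_chain_eq_id[OF assms] by (auto simp: lattice_automorphism_def)
  have "integral_operator_classes = (\<lambda>P :: 'a \<Rightarrow> 'a. {P}) ` {P. integral_operator P}"
    by (auto simp: integral_operator_classes_def integral_operator_iso_def quotient_def aut)
  then show ?thesis
    by (rule ssubst) (simp add: card_image inj_on_def)
qed

theorem proposition3p6:
  fixes n :: nat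
  assumes "n > 0"
    and "CARD('a::{linorder,lattice}) = n"
  shows "card (integral_operator_classes :: ('a \<Rightarrow> 'a) set set) = fib (2 * n)"
proof -
  have fin: "finite (UNIV :: 'a set)"
    using assms by (intro card_ge_0_finite) simp
  obtain k where k: "n = Suc k" using assms(1) by (cases n) auto
  have "card (integral_operator_classes :: ('a \<Rightarrow> 'a) set set)
      = card (monotone_idempotents (UNIV :: 'a set))"
    by (simp add: card_integral_operator_classes_finite_chain[OF fin]
          integral_operator_linorder_iff monotone_idempotents_UNIV)
  also have "\<dots> = fib (2 * n)"
    using card_monotone_idempotents[OF fin] assms(2) k by simp
  finally show ?thesis .
qed

end
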